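(* Let $\mathcal W,\mathcal T$ be measurable spaces and $\mathbf P(W|T):\mathcal T\dashrightarrow\mathcal W$ a Markov kernel; put $\mathbf P_t(W):=\mathbf P(W|T=t)$ and $\mathcal E:=(\mathbf P_t(W))_{t\in\mathcal T}$. Let $X,Y,Z$ be measurable maps on $\mathcal W$ (into measurable spaces $\mathcal X,\mathcal Y,\mathcal Z$) and $\Phi,\Theta$ measurable maps on $\mathcal T$ such that the joint map $(\Phi,\Theta)$ is injective. Consider $X$, $(Y,\Theta)$ and $(Z,\Phi)$ as transitional random variables on $(\mathcal W\times\mathcal T,\mathbf P(W|T))$ via $(w,t)\mapsto X(w)$, $(Y(w),\Theta(t))$, $(Z(w),\Phi(t))$. Then transitional conditional independence implies extended conditional independence: $$X\perp\!\!\!\perp_{\mathbf P(W|T)}(Y,\Theta)\mid(Z,\Phi)\quad\implies\quad X\perp\!\!\!\perp_{\mathcal E}(Y,\Theta)\mid(Z,\Phi).$$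
   Context: A Markov kernel $\mathbf P(W|T):\mathcal T\dashrightarrow\mathcal W$ assigns to each $t$ a probability measure $\mathbf P(W|T=t)$ on $\mathcal W$, measurably in $t$ on each measurable set. Transitional conditional independence: for measurable maps $F,G,H$ on $\mathcal W\times\mathcal T$ with values in $\mathcal F,\mathcal G,\mathcal H$ let $\mathbf P(F,G,H|T=t)$ be the law of $(F,G,H)(w,t)$ for $w\sim\mathbf P(W|T=t)$. $F\perp\!\!\!\perp_{\mathbf P(W|T)}G\mid H$ means: there exists a Markov kernel $\mathbf Q(F|H):\mathcal H\dashrightarrow\mathcal F$ such that for all $t$ and measurable $A,B,C$: $\mathbf P(F\in A,G\in B,H\in C|T=t)=\int\mathbf 1_B(g)\mathbf 1_C(h)\,\mathbf Q(F\in A|H=h)\,\mathbf P((G,H)\in d(g,h)|T=t)$. Extended conditional independence: $X\perp\!\!\!\perp_{\mathcal E}(Y,\Theta)\mid(Z,\Phi)$ means: for all $\phi\in\Phi(\mathcal T)$ and all real bounded measurable functions $h$ on $\mathcal X$ there exists a function $g_{h,\phi}$ on $\mathcal Z$ such that for all $t\in\Phi^{-1}(\phi)$: $\mathbb E_t[h(X)|Y,Z]=g_{h,\phi}(Z)$ $\mathbf P_t(W)$-almost surely, where $\mathbb E_t$ denotes (conditional) expectation with respect to $\mathbf P_t(W)$. *)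

theory Defs
  imports "HOL-Probability.Probability"
begin

(* A Markov kernel T --> W is an element of "T \<rightarrow>\<^sub>M prob_algebra W"; K t is the measure P(W | T = t). *)

definition trans_law ::
  "('t \<Rightarrow> 'w measure) \<Rightarrow> 'a measure \<Rightarrow> ('w \<times> 't \<Rightarrow> 'a) \<Rightarrow> 't \<Rightarrow> 'a measure"
where
  "trans_law K M F t = distr (K t) M (\<lambda>w. F (w, t))"

(* F, G, H are meant to be measurable on the product of the spaces W and T. *)
definition trans_cond_indep ::
  "'t measure \<Rightarrow> ('t \<Rightarrow> 'w measure) \<Rightarrow> 'f measure \<Rightarrow> 'g measure \<Rightarrow> 'h measure \<Rightarrow>
   ('w \<times> 't \<Rightarrow> 'f) \<Rightarrow> ('w \<times> 't \<Rightarrow> 'g) \<Rightarrow> ('w \<times> 't \<Rightarrow> 'h) \<Rightarrow> bool"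
where
  "trans_cond_indep T K MF MG MH F G H \<longleftrightarrow>
     (\<exists>Q \<in> MH \<rightarrow>\<^sub>M prob_algebra MF.
        \<forall>t \<in> space T. \<forall>A \<in> sets MF. \<forall>B \<in> sets MG. \<forall>C \<in> sets MH.
          emeasure (trans_law K (MF \<Otimes>\<^sub>M MG \<Otimes>\<^sub>M MH) (\<lambda>x. (F x, G x, H x)) t) (A \<times> B \<times> C) =
          (\<integral>\<^sup>+(g, h). indicator B g * indicator C h * emeasure (Q h) A
             \<partial>trans_law K (MG \<Otimes>\<^sub>M MH) (\<lambda>x. (G x, H x)) t))"

(* \<Theta> occurs only on the left: it is part of the notation X \<bottom> (Y, \<Theta>) | (Z, \<Phi>), but the defining
   condition does not refer to it. The function g is not required to be measurable. *)
definition ext_cond_indep ::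
  "'t measure \<Rightarrow> ('t \<Rightarrow> 'w measure) \<Rightarrow> 'x measure \<Rightarrow> 'y measure \<Rightarrow> 'z measure \<Rightarrow>
   ('w \<Rightarrow> 'x) \<Rightarrow> ('w \<Rightarrow> 'y) \<Rightarrow> ('t \<Rightarrow> 'b) \<Rightarrow> ('w \<Rightarrow> 'z) \<Rightarrow> ('t \<Rightarrow> 'a) \<Rightarrow> bool"
where
  "ext_cond_indep T K MX MY MZ X Y \<Theta> Z \<Phi> \<longleftrightarrow>
     (\<forall>\<phi> \<in> \<Phi> ` space T. \<forall>h \<in> borel_measurable MX. bounded (h ` space MX) \<longrightarrow>
        (\<exists>g :: 'z \<Rightarrow> real. \<forall>t \<in> \<Phi> -` {\<phi>} \<inter> space T.
           AE w in K t.
             real_cond_exp (K t)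
               (vimage_algebra (space (K t)) (\<lambda>w. (Y w, Z w)) (MY \<Otimes>\<^sub>M MZ))
               (\<lambda>w. h (X w)) w = g (Z w)))"

end

theory Submission
  imports Defs
begin

text \<open>
  Let \<open>Q\<close> be the kernel that witnesses transitional conditional independence. For a fixed value
  \<open>\<phi>\<close> of \<open>\<Phi>\<close>, the slice \<open>Q(\<cdot>, \<phi>)\<close> is a kernel from the space of \<open>Z\<close> to that of \<open>X\<close>, and it
  depends on \<open>t\<close> only through \<open>\<phi>\<close>. Under each \<open>K t\<close> with \<open>\<Phi> t = \<phi>\<close> it is a regular conditional
  distribution of \<open>X\<close> given \<open>(Y, Z)\<close>: the independence hypothesis, read on boxes that leave
  \<open>\<Theta>\<close> and \<open>\<Phi>\<close> unrestricted, says that the joint law of \<open>(X, (Y, Z))\<close> agrees on boxes with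
  the law obtained by drawing \<open>(Y, Z)\<close> and then \<open>X\<close> from \<open>Q(Z, \<phi>)\<close>, and boxes determine a
  probability measure (\<open>prob_measure_eqI_box\<close>). Conditional expectations are integrals against a
  regular conditional distribution (\<open>real_cond_exp_disintegration\<close>), so
  \<open>g(z) = \<integral> h dQ(z, \<phi>)\<close> is a version of the conditional expectation of \<open>h(X)\<close> simultaneously
  for all such \<open>t\<close>.
\<close>

text \<open>Boxes are stable under intersection, and generate the nested product because the rectangles
  generate its second factor and contain the whole space.\<close>

lemma prob_measure_eqI_box:
  assumes M: "M \<in> space (prob_algebra (A \<Otimes>\<^sub>M (B \<Otimes>\<^sub>M C)))"
    and N: "N \<in> space (prob_algebra (A \<Otimes>\<^sub>M (B \<Otimes>\<^sub>M C)))"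
    and eq: "\<And>a b c. a \<in> sets A \<Longrightarrow> b \<in> sets B \<Longrightarrow> c \<in> sets C \<Longrightarrow>
      emeasure M (a \<times> b \<times> c) = emeasure N (a \<times> b \<times> c)"
  shows "M = N"
proof (rule measure_eqI_generator_eq)
  let ?R = "{b \<times> c | b c. b \<in> sets B \<and> c \<in> sets C}"
  let ?E = "{a \<times> r | a r. a \<in> sets A \<and> r \<in> ?R}"
  let ?\<Omega> = "space A \<times> space (B \<Otimes>\<^sub>M C)"
  have R: "?R \<subseteq> Pow (space (B \<Otimes>\<^sub>M C))"
    by (auto simp: space_pair_measure dest: sets.sets_into_space)
  show E: "?E \<subseteq> Pow ?\<Omega>"
    using R by (auto simp: subset_eq dest: sets.sets_into_space)
  have box: "a \<times> b \<times> c \<in> ?E" if "a \<in> sets A" "b \<in> sets B" "c \<in> sets C" for a b c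
    using that by blast
  show "Int_stable ?E"
  proof (rule Int_stableI)
    fix p q assume "p \<in> ?E" "q \<in> ?E"
    then obtain a b c a' b' c' where "p = a \<times> b \<times> c" "q = a' \<times> b' \<times> c'"
      "a \<in> sets A" "b \<in> sets B" "c \<in> sets C" "a' \<in> sets A" "b' \<in> sets B" "c' \<in> sets C"
      by blast
    then show "p \<inter> q \<in> ?E"
      using box[of "a \<inter> a'" "b \<inter> b'" "c \<inter> c'"] by (simp only: Times_Int_Times) blast
  qed
  have "sets (A \<Otimes>\<^sub>M (B \<Otimes>\<^sub>M C)) = sets (sigma ?\<Omega> ?E)"
  proof (rule sets_pair_eq[where Ca = "{space A}" and Cb = "{space B \<times> space C}"])
    show "sets (B \<Otimes>\<^sub>M C) = sigma_sets (space (B \<Otimes>\<^sub>M C)) ?R"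
      by (simp add: sets_pair_measure space_pair_measure)
  qed (use R in \<open>auto simp: space_pair_measure sets.sigma_sets_eq dest: sets.sets_into_space\<close>)
  with E have sets: "sets (A \<Otimes>\<^sub>M (B \<Otimes>\<^sub>M C)) = sigma_sets ?\<Omega> ?E"
    by simp
  show "sets M = sigma_sets ?\<Omega> ?E" "sets N = sigma_sets ?\<Omega> ?E"
    using M N sets by (auto simp: space_prob_algebra)
  show "emeasure M p = emeasure N p" if "p \<in> ?E" for p
    using that eq by blast
  show "range (\<lambda>_::nat. ?\<Omega>) \<subseteq> ?E"
    using box[of "space A" "space B" "space C"] by (auto simp: space_pair_measure)
  show "emeasure M ?\<Omega> \<noteq> \<infinity>"
    using in_space_prob_algebra[OF M] by (simp add: space_pair_measure)
qed auto

text \<open>A regular conditional distribution \<open>Q\<close> of \<open>X\<close> given \<open>V\<close> computes conditional expectations.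
  An event generated by \<open>V\<close> has the form \<open>V \<in> D\<close>, and integrating \<open>h(x) 1\<^sub>D(v)\<close> against both
  sides of the disintegration \<open>law\<close> gives the defining equation of the conditional expectation.\<close>

lemma (in prob_space) real_cond_exp_disintegration:
  fixes h :: "'x \<Rightarrow> real"
  assumes X[measurable]: "X \<in> M \<rightarrow>\<^sub>M MX" and V[measurable]: "V \<in> M \<rightarrow>\<^sub>M MV"
    and Q[measurable]: "Q \<in> MV \<rightarrow>\<^sub>M prob_algebra MX"
    and law: "distr M (MX \<Otimes>\<^sub>M MV) (\<lambda>w. (X w, V w)) =
      M \<bind> (\<lambda>w. distr (Q (V w)) (MX \<Otimes>\<^sub>M MV) (\<lambda>x. (x, V w)))"
    and h[measurable]: "h \<in> borel_measurable MX" and bdd: "bounded (h ` space MX)"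
  shows "AE w in M. real_cond_exp M (vimage_algebra (space M) V MV) (\<lambda>w. h (X w)) w =
    (\<integral>x. h x \<partial>Q (V w))"
proof -
  let ?F = "vimage_algebra (space M) V MV"
  let ?g = "\<lambda>v. \<integral>x. h x \<partial>Q v"
  let ?k = "\<lambda>w. distr (Q (V w)) (MX \<Otimes>\<^sub>M MV) (\<lambda>x. (x, V w))"
  have V_space: "V w \<in> space MV" if "w \<in> space M" for w
    using measurable_space[OF V that] .
  have Q_prob: "prob_space (Q v)" and Q_sets: "sets (Q v) = sets MX" if "v \<in> space MV" for v
    using measurable_space[OF Q that] by (auto simp: space_prob_algebra)
  have Q_space: "space (Q v) = space MX" if "v \<in> space MV" for v
    using sets_eq_imp_space_eq[OF Q_sets[OF that]] .
  obtain c where c: "\<bar>h x\<bar> \<le> c" if "x \<in> space MX" for x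
    using bdd unfolding bounded_iff by auto
  have c0: "\<bar>h x * indicator D v\<bar> \<le> c" if "x \<in> space MX" for x and D :: "'c set" and v
    using c[OF that] by (auto simp: indicator_def)
  have g_meas[measurable]: "?g \<in> borel_measurable MV"
    by (rule measurable_compose[OF measurable_prob_algebraD[OF Q]])
       (rule integral_measurable_subprob_algebra[OF h])
  have g_bound: "\<bar>?g v\<bar> \<le> c" if v: "v \<in> space MV" for v
  proof -
    interpret Q: prob_space "Q v" by (rule Q_prob[OF v])
    have "integrable (Q v) h"
      by (rule Q.integrable_const_bound[where B = c])
         (auto simp: Q_space[OF v] c measurable_cong_sets[OF Q_sets[OF v] refl])
    then have "?g v \<le> c" "- c \<le> ?g v"
      using c by (auto simp: Q_space[OF v] abs_le_iff minus_le_iff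
          intro!: Q.integral_le_const Q.integral_ge_const AE_I2)
    then show ?thesis by auto
  qed
  have sub: "subalgebra M ?F"
    unfolding subalgebra_def using sets_vimage_algebra2[of V "space M" MV] V
    by (auto simp: measurable_sets V_space)
  interpret F: finite_measure_subalgebra M ?F
    by unfold_locales (rule sub)
  have k[measurable]: "?k \<in> M \<rightarrow>\<^sub>M prob_algebra (MX \<Otimes>\<^sub>M MV)"
    by (rule measurable_distr_prob_space2[where M = MX]) measurable
  show ?thesis
  proof (rule F.real_cond_exp_charact)
    show "integrable M (\<lambda>w. h (X w))"
      by (rule integrable_const_bound[where B = c])
         (auto intro!: c measurable_space[OF X])
    show "integrable M (\<lambda>w. ?g (V w))"
      by (rule integrable_const_bound[where B = c])
         (auto intro!: g_bound V_space)
    show "(\<lambda>w. ?g (V w)) \<in> borel_measurable ?F"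
      by (rule measurable_compose[OF _ g_meas])
         (rule measurable_vimage_algebra1, auto intro: V_space)
    fix S assume "S \<in> sets ?F"
    then obtain D where D[measurable]: "D \<in> sets MV" and S: "S = V -` D \<inter> space M"
      using sets_vimage_algebra2[of V "space M" MV] V_space by auto
    let ?f = "\<lambda>p. h (fst p) * indicator D (snd p)"
    have "(\<integral>w\<in>S. h (X w) \<partial>M) = (\<integral>w. ?f (X w, V w) \<partial>M)"
      unfolding set_lebesgue_integral_def
      by (rule Bochner_Integration.integral_cong) (auto simp: S indicator_def)
    also have "\<dots> = (\<integral>p. ?f p \<partial>distr M (MX \<Otimes>\<^sub>M MV) (\<lambda>w. (X w, V w)))"
      by (rule integral_distr[symmetric]) measurable
    also have "\<dots> = (\<integral>w. (\<integral>p. ?f p \<partial>?k w) \<partial>M)"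
      unfolding law
    proof (rule integral_bind[where K = "MX \<Otimes>\<^sub>M MV" and B = c and B' = 1])
      show "AE w in M. emeasure (?k w) (space (?k w)) \<le> ennreal 1"
        using measurable_space[OF k]
        by (auto simp: space_prob_algebra simp del: space_distr
          intro!: AE_I2 prob_space.emeasure_le_1)
      show "\<bar>?f p\<bar> \<le> c" if "p \<in> space (MX \<Otimes>\<^sub>M MV)" for p
        using that c0[of "fst p"] by (auto simp: space_pair_measure)
    qed (use k in \<open>auto intro: measurable_prob_algebraD finite_measure_axioms\<close>)
    also have "\<dots> = (\<integral>w\<in>S. ?g (V w) \<partial>M)"
      unfolding set_lebesgue_integral_def
    proof (rule Bochner_Integration.integral_cong[OF refl])
      fix w assume w: "w \<in> space M"
      have "(\<integral>p. ?f p \<partial>?k w) = (\<integral>x. ?f (x, V w) \<partial>Q (V w))"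
        using V_space[OF w] Q_sets[OF V_space[OF w]]
        by (intro integral_distr) (auto cong: measurable_cong_sets)
      then show "(\<integral>p. ?f p \<partial>?k w) = indicator S w *\<^sub>R ?g (V w)"
        using w by (auto simp: S indicator_def)
    qed
    finally show "(\<integral>w\<in>S. h (X w) \<partial>M) = (\<integral>w\<in>S. ?g (V w) \<partial>M)" .
  qed
qed

theorem lemmaJ11:
  fixes W :: "'w measure" and T :: "'t measure" and K :: "'t \<Rightarrow> 'w measure"
    and MX :: "'x measure" and MY :: "'y measure" and MZ :: "'z measure"
    and M\<Phi> :: "'a measure" and M\<Theta> :: "'b measure"
    and X :: "'w \<Rightarrow> 'x" and Y :: "'w \<Rightarrow> 'y" and Z :: "'w \<Rightarrow> 'z"
    and \<Phi> :: "'t \<Rightarrow> 'a" and \<Theta> :: "'t \<Rightarrow> 'b"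
  assumes "K \<in> T \<rightarrow>\<^sub>M prob_algebra W"
    and "X \<in> W \<rightarrow>\<^sub>M MX" and "Y \<in> W \<rightarrow>\<^sub>M MY" and "Z \<in> W \<rightarrow>\<^sub>M MZ"
    and "\<Phi> \<in> T \<rightarrow>\<^sub>M M\<Phi>" and "\<Theta> \<in> T \<rightarrow>\<^sub>M M\<Theta>"
    and "inj_on (\<lambda>t. (\<Phi> t, \<Theta> t)) (space T)"
    and "trans_cond_indep T K MX (MY \<Otimes>\<^sub>M M\<Theta>) (MZ \<Otimes>\<^sub>M M\<Phi>)
           (\<lambda>(w, t). X w) (\<lambda>(w, t). (Y w, \<Theta> t)) (\<lambda>(w, t). (Z w, \<Phi> t))"
  shows "ext_cond_indep T K MX MY MZ X Y \<Theta> Z \<Phi>"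
  unfolding ext_cond_indep_def
proof (intro ballI impI)
  fix \<phi> and h :: "'x \<Rightarrow> real"
  assume h: "h \<in> borel_measurable MX" "bounded (h ` space MX)"
  obtain Q where Q[measurable]: "Q \<in> MZ \<Otimes>\<^sub>M M\<Phi> \<rightarrow>\<^sub>M prob_algebra MX"
    and indep: "\<And>t A B C. t \<in> space T \<Longrightarrow> A \<in> sets MX \<Longrightarrow>
      B \<in> sets (MY \<Otimes>\<^sub>M M\<Theta>) \<Longrightarrow> C \<in> sets (MZ \<Otimes>\<^sub>M M\<Phi>) \<Longrightarrow>
      emeasure (distr (K t) (MX \<Otimes>\<^sub>M (MY \<Otimes>\<^sub>M M\<Theta>) \<Otimes>\<^sub>M (MZ \<Otimes>\<^sub>M M\<Phi>))
          (\<lambda>w. (X w, (Y w, \<Theta> t), (Z w, \<Phi> t)))) (A \<times> B \<times> C) =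
      (\<integral>\<^sup>+p. indicator B (fst p) * indicator C (snd p) * emeasure (Q (snd p)) A
         \<partial>distr (K t) ((MY \<Otimes>\<^sub>M M\<Theta>) \<Otimes>\<^sub>M (MZ \<Otimes>\<^sub>M M\<Phi>)) (\<lambda>w. ((Y w, \<Theta> t), (Z w, \<Phi> t))))"
    using assms(8) unfolding trans_cond_indep_def trans_law_def split_beta' fst_conv snd_conv
    by blast
  show "\<exists>g :: 'z \<Rightarrow> real. \<forall>t \<in> \<Phi> -` {\<phi>} \<inter> space T. AE w in K t.
      real_cond_exp (K t) (vimage_algebra (space (K t)) (\<lambda>w. (Y w, Z w)) (MY \<Otimes>\<^sub>M MZ))
        (\<lambda>w. h (X w)) w = g (Z w)"
  proof (intro exI ballI)
    fix t assume "t \<in> \<Phi> -` {\<phi>} \<inter> space T"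
    then have t: "t \<in> space T" and \<phi>: "\<phi> = \<Phi> t" by auto
    have \<Phi>t[measurable]: "\<Phi> t \<in> space M\<Phi>" and \<Theta>t[measurable]: "\<Theta> t \<in> space M\<Theta>"
      using assms(5,6) t by (auto intro: measurable_space)
    have K: "sets (K t) = sets W" "prob_space (K t)"
      using measurable_space[OF assms(1) t] by (auto simp: space_prob_algebra)
    interpret P: prob_space "K t" by (rule K(2))
    have [measurable]: "X \<in> K t \<rightarrow>\<^sub>M MX" "Y \<in> K t \<rightarrow>\<^sub>M MY" "Z \<in> K t \<rightarrow>\<^sub>M MZ"
      using assms(2-4) by (simp_all add: measurable_cong_sets[OF K(1) refl])
    let ?V = "\<lambda>w. (Y w, Z w)" and ?Q = "\<lambda>v. Q (snd v, \<phi>)"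
    let ?k = "\<lambda>w. distr (?Q (?V w)) (MX \<Otimes>\<^sub>M (MY \<Otimes>\<^sub>M MZ)) (\<lambda>x. (x, ?V w))"
    have Q'[measurable]: "?Q \<in> MY \<Otimes>\<^sub>M MZ \<rightarrow>\<^sub>M prob_algebra MX"
      unfolding \<phi> by measurable
    have k: "?k \<in> K t \<rightarrow>\<^sub>M prob_algebra (MX \<Otimes>\<^sub>M (MY \<Otimes>\<^sub>M MZ))"
      by (rule measurable_distr_prob_space2[where M = MX]) measurable
    have Kt: "K t \<in> space (prob_algebra (K t))"
      by (simp add: space_prob_algebra K(2))
    have "distr (K t) (MX \<Otimes>\<^sub>M (MY \<Otimes>\<^sub>M MZ)) (\<lambda>w. (X w, ?V w)) = K t \<bind> ?k"
    proof (rule prob_measure_eqI_box)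
      show "distr (K t) (MX \<Otimes>\<^sub>M (MY \<Otimes>\<^sub>M MZ)) (\<lambda>w. (X w, ?V w))
          \<in> space (prob_algebra (MX \<Otimes>\<^sub>M (MY \<Otimes>\<^sub>M MZ)))"
        by (auto simp: space_prob_algebra intro!: P.prob_space_distr)
      show "K t \<bind> ?k \<in> space (prob_algebra (MX \<Otimes>\<^sub>M (MY \<Otimes>\<^sub>M MZ)))"
        using prob_space_bind'[OF Kt k] sets_bind'[OF Kt k] by (simp add: space_prob_algebra)
      fix A B C assume A[measurable]: "A \<in> sets MX" and B[measurable]: "B \<in> sets MY"
        and C[measurable]: "C \<in> sets MZ"
      let ?B = "B \<times> space M\<Theta>" and ?C = "C \<times> space M\<Phi>"
      have [measurable]: "(\<lambda>p. emeasure (Q p) A) \<in> borel_measurable (MZ \<Otimes>\<^sub>M M\<Phi>)"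
        by (rule measurable_compose[OF measurable_prob_algebraD[OF Q]
              measurable_emeasure_subprob_algebra[OF A]])
      \<comment> \<open>For fixed \<open>t\<close> the membership of \<open>\<Theta> t\<close> and \<open>\<Phi> t\<close> in the whole spaces holds for every
        \<open>w\<close>, so these larger boxes carry the same event of \<open>K t\<close>.\<close>
      have "emeasure (distr (K t) (MX \<Otimes>\<^sub>M (MY \<Otimes>\<^sub>M MZ)) (\<lambda>w. (X w, ?V w))) (A \<times> B \<times> C) =
          emeasure (distr (K t) (MX \<Otimes>\<^sub>M (MY \<Otimes>\<^sub>M M\<Theta>) \<Otimes>\<^sub>M (MZ \<Otimes>\<^sub>M M\<Phi>))
            (\<lambda>w. (X w, (Y w, \<Theta> t), (Z w, \<Phi> t)))) (A \<times> ?B \<times> ?C)"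
        using \<Phi>t \<Theta>t by (subst (1 2) emeasure_distr) (auto intro!: arg_cong[where f = "emeasure (K t)"])
      also have "\<dots> = (\<integral>\<^sup>+p. indicator ?B (fst p) * indicator ?C (snd p) * emeasure (Q (snd p)) A
         \<partial>distr (K t) ((MY \<Otimes>\<^sub>M M\<Theta>) \<Otimes>\<^sub>M (MZ \<Otimes>\<^sub>M M\<Phi>)) (\<lambda>w. ((Y w, \<Theta> t), (Z w, \<Phi> t))))"
        by (rule indep[OF t]) auto
      also have "\<dots> = (\<integral>\<^sup>+w. indicator ?B (Y w, \<Theta> t) * indicator ?C (Z w, \<Phi> t) *
          emeasure (Q (Z w, \<Phi> t)) A \<partial>K t)"
        by (subst nn_integral_distr) auto
      also have "\<dots> = (\<integral>\<^sup>+w. emeasure (?k w) (A \<times> B \<times> C) \<partial>K t)"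
      proof (rule nn_integral_cong)
        fix w assume w: "w \<in> space (K t)"
        have sQ: "sets (Q (Z w, \<phi>)) = sets MX"
          using measurable_space[OF Q, of "(Z w, \<phi>)"] measurable_space[OF \<open>Z \<in> K t \<rightarrow>\<^sub>M MZ\<close> w] \<Phi>t
          by (auto simp: space_prob_algebra space_pair_measure \<phi>)
        have V: "?V w \<in> space (MY \<Otimes>\<^sub>M MZ)"
          using w by (auto simp: space_pair_measure intro: measurable_space)
        have "emeasure (?k w) (A \<times> B \<times> C) =
            emeasure (Q (Z w, \<phi>)) ((\<lambda>x. (x, ?V w)) -` (A \<times> B \<times> C) \<inter> space MX)"
          using V by (subst emeasure_distr)
            (auto simp: measurable_cong_sets[OF sQ refl] sets_eq_imp_space_eq[OF sQ])
        also have "(\<lambda>x. (x, ?V w)) -` (A \<times> B \<times> C) \<inter> space MX =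
            (if Y w \<in> B \<and> Z w \<in> C then A else {})"
          using sets.sets_into_space[OF A] by auto
        finally show "indicator ?B (Y w, \<Theta> t) * indicator ?C (Z w, \<Phi> t) * emeasure (Q (Z w, \<Phi> t)) A =
            emeasure (?k w) (A \<times> B \<times> C)"
          using \<Phi>t \<Theta>t by (auto simp: \<phi> indicator_def)
      qed
      also have "\<dots> = emeasure (K t \<bind> ?k) (A \<times> B \<times> C)"
        by (rule emeasure_bind_prob_algebra[OF Kt k, symmetric]) measurable
      finally show "emeasure (distr (K t) (MX \<Otimes>\<^sub>M (MY \<Otimes>\<^sub>M MZ)) (\<lambda>w. (X w, ?V w))) (A \<times> B \<times> C) =
        emeasure (K t \<bind> ?k) (A \<times> B \<times> C)" .
    qed
    from P.real_cond_exp_disintegration[OF _ _ Q' this h]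
    show "AE w in K t.
      real_cond_exp (K t) (vimage_algebra (space (K t)) (\<lambda>w. (Y w, Z w)) (MY \<Otimes>\<^sub>M MZ))
        (\<lambda>w. h (X w)) w = (\<lambda>z. \<integral>x. h x \<partial>Q (z, \<phi>)) (Z w)"
      by simp
  qed
qed

end
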